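(* Let $k\ge 2$ be an integer and let $n$ be an integer with $n\ge k+\lfloor\sqrt{k-1}\rfloor+2$. If $G$ is a $(C_4,K_{1,k})$-co-critical graph on $n$ vertices, then \[ e(G)\ge \frac{(k+2)n}{2}-3-\frac{(k-1)(k+\lfloor\sqrt{k-2}\rfloor)}{2}. \]
   Context: All graphs are finite, simple, without loops or multiple edges; $e(G)$ denotes the number of edges of $G$. For a graph $G$, a $\{\text{red},\text{blue}\}$-coloring of $E(G)$ is a critical coloring if $G$ contains neither a red copy of $C_4$ (the cycle on 4 vertices, as a not necessarily induced subgraph) nor a blue copy of $K_{1,k}$ (the star with $k$ leaves). A non-complete graph $G$ is $(C_4,K_{1,k})$-co-critical if $G$ admits a critical coloring, but for every edge $e$ of the complement of $G$, the graph $G+e$ (obtained by adding $e$) admits no critical coloring. *)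

theory Defs
  imports Complex_Main
begin

type_synonym 'a graph = "'a set \<times> 'a set set"

definition verts :: "'a graph \<Rightarrow> 'a set" where
  "verts G = fst G"

definition edges :: "'a graph \<Rightarrow> 'a set set" where
  "edges G = snd G"

definition pairs_of :: "'a set \<Rightarrow> 'a set set" where
  "pairs_of V = {e. e \<subseteq> V \<and> card e = 2}"

definition simple_graph :: "'a graph \<Rightarrow> bool" where
  "simple_graph G \<longleftrightarrow> finite (verts G) \<and> edges G \<subseteq> pairs_of (verts G)"

definition complete_graph :: "'a graph \<Rightarrow> bool" where
  "complete_graph G \<longleftrightarrow> edges G = pairs_of (verts G)"

definition complement_edges :: "'a graph \<Rightarrow> 'a set set" where
  "complement_edges G = pairs_of (verts G) - edges G"

definition add_edge :: "'a graph \<Rightarrow> 'a set \<Rightarrow> 'a graph" where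
  "add_edge G e = (verts G, insert e (edges G))"

(* Copies are subgraphs that need not be induced: edges of H go to edges of G,
   non-edges of H are unconstrained. *)
definition contains_copy :: "'a graph \<Rightarrow> 'b graph \<Rightarrow> bool" where
  "contains_copy G H \<longleftrightarrow>
     (\<exists>f. inj_on f (verts H) \<and> f ` verts H \<subseteq> verts G \<and> (\<forall>e\<in>edges H. f ` e \<in> edges G))"

definition C4 :: "nat graph" where
  "C4 = ({0, 1, 2, 3}, {{0, 1}, {1, 2}, {2, 3}, {3, 0}})"

(* K_{1,k}, with centre 0 and leaves 1, ..., k. *)
definition star :: "nat \<Rightarrow> nat graph" where
  "star k = ({0..k}, {{0, i} | i. i \<in> {1..k}})"

datatype colour = Red | Blue

(* A colouring of E(G) is represented by a total function; its values off
   edges G are irrelevant. *)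
definition colour_class :: "'a graph \<Rightarrow> ('a set \<Rightarrow> colour) \<Rightarrow> colour \<Rightarrow> 'a graph" where
  "colour_class G c x = (verts G, {e \<in> edges G. c e = x})"

definition critical_colouring :: "nat \<Rightarrow> 'a graph \<Rightarrow> ('a set \<Rightarrow> colour) \<Rightarrow> bool" where
  "critical_colouring k G c \<longleftrightarrow>
     \<not> contains_copy (colour_class G c Red) C4 \<and>
     \<not> contains_copy (colour_class G c Blue) (star k)"

definition co_critical :: "nat \<Rightarrow> 'a graph \<Rightarrow> bool" where
  "co_critical k G \<longleftrightarrow>
     \<not> complete_graph G \<and>
     (\<exists>c. critical_colouring k G c) \<and>
     (\<forall>e\<in>complement_edges G. \<not> (\<exists>c. critical_colouring k (add_edge G e) c))"

end

theory Submission
  imports Defs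
begin

text \<open>
  Take a critical colouring with as many red edges as possible. Recolouring a blue edge red, or
  adding a non-edge in red, must create a red 4-cycle, so the red graph is \<open>C\<^sub>4\<close>-saturated and hence
  has at least \<open>3n/2 - 3\<close> edges (a weak form of Ollmann's theorem). Adding a non-edge in blue must
  create a blue star, so the vertices of blue degree at most \<open>k - 2\<close> form a clique \<open>S\<close>. A vertex of \<open>S\<close>
  has at least \<open>|S| - k + 1\<close> red neighbours in \<open>S\<close>; counting red paths of length two bounds \<open>|S|\<close>, and
  with it the amount by which the blue degree sum falls short of \<open>(k - 1)n\<close>. For \<open>k = 2\<close>
  the sum of the two bounds can be one too small for twice the number of edges, and parity repairs it.
\<close>

lemma card_le_1_if: 
  assumes "\<And>x y. x \<in> X \<Longrightarrow> y \<in> X \<Longrightarrow> x = y"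
  shows "card X \<le> 1"
  by (metis assms card.infinite card_le_Suc0_iff_eq One_nat_def zero_le)

section \<open>Graphs without 4-cycles\<close>

locale sgraph =
  fixes V :: "'a set" and R :: "'a \<Rightarrow> 'a \<Rightarrow> bool"
  assumes finite_V: "finite V"
    and sym: "R u v \<Longrightarrow> R v u"
    and irrefl: "\<not> R v v"
    and in_V: "R u v \<Longrightarrow> u \<in> V"
begin

definition nb :: "'a \<Rightarrow> 'a set" where "nb v = {w. R v w}"

abbreviation deg :: "'a \<Rightarrow> nat" where "deg v \<equiv> card (nb v)"

lemma mem_nb [simp]: "w \<in> nb v \<longleftrightarrow> R v w"
  by (simp add: nb_def)

lemma nb_subset: "nb v \<subseteq> V"
  using in_V sym by (metis mem_nb subsetI)

lemma finite_nb [simp]: "finite (nb v)"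
  using finite_V nb_subset finite_subset by blast

lemma double_count:
  assumes "finite A" "finite B"
  shows "(\<Sum>a\<in>A. card (nb a \<inter> B)) = (\<Sum>b\<in>B. card (nb b \<inter> A))"
proof -
  have *: "card (nb a \<inter> X) = (\<Sum>b\<in>X. if R a b then 1 else 0)" if "finite X" for a X
  proof -
    have "nb a \<inter> X = {b \<in> X. R a b}" by auto
    then show ?thesis using that by (simp flip: sum.inter_filter)
  qed
  have "(\<Sum>a\<in>A. card (nb a \<inter> B)) = (\<Sum>a\<in>A. \<Sum>b\<in>B. if R a b then 1 else 0)"
    using assms by (simp add: *)
  also have "\<dots> = (\<Sum>b\<in>B. \<Sum>a\<in>A. if R a b then 1 else 0)" by (rule sum.swap)
  also have "\<dots> = (\<Sum>b\<in>B. card (nb b \<inter> A))"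
    unfolding *[OF assms(1)] by (intro sum.cong refl if_cong) (use sym in blast)+
  finally show ?thesis .
qed

end

text \<open>The 4-cycle condition in the form used for counting: distinct \<open>b\<close> and
  \<open>d\<close> with two common neighbours \<open>a\<close>, \<open>c\<close> would close the
  cycle \<open>b\<close>, \<open>a\<close>, \<open>d\<close>, \<open>c\<close>.\<close>

locale C4_free_graph = sgraph +
  assumes C4_free: "R b a \<Longrightarrow> R b c \<Longrightarrow> R d a \<Longrightarrow> R d c \<Longrightarrow> a \<noteq> c \<Longrightarrow> b = d"
begin

text \<open>The left side counts ordered pairs of distinct vertices of \<open>S\<close> by their
  common neighbours in \<open>S\<close>. Common neighbours are unique, so no pair is counted
  twice.\<close>

lemma sum_cherries_le:
  assumes "S \<subseteq> V"
  shows "(\<Sum>v\<in>S. card (nb v \<inter> S) * (card (nb v \<inter> S) - 1)) \<le> card S * (card S - 1)"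
proof -
  have fS: "finite S" using assms finite_V finite_subset by blast
  let ?P = "\<lambda>X. {(u, w). u \<in> X \<and> w \<in> X \<and> u \<noteq> w}"
  have cP: "card (?P X) = card X * (card X - 1)" if "finite X" for X :: "'a set"
  proof -
    have "?P X = (SIGMA u:X. X - {u})" by auto
    then have "card (?P X) = (\<Sum>u\<in>X. card (X - {u}))" using that by simp
    also have "\<dots> = (\<Sum>u\<in>X. card X - 1)" by (rule sum.cong) auto
    finally show ?thesis by simp
  qed
  have fP: "finite (?P X)" if "finite X" for X :: "'a set"
    by (rule finite_subset[of _ "X \<times> X"]) (use that in auto)
  have "(\<Sum>v\<in>S. card (nb v \<inter> S) * (card (nb v \<inter> S) - 1)) = (\<Sum>v\<in>S. card (?P (nb v \<inter> S)))"
    by (intro sum.cong refl cP[symmetric]) simp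
  also have "\<dots> = card (\<Union>v\<in>S. ?P (nb v \<inter> S))"
  proof (rule card_UN_disjoint[symmetric])
    show "\<forall>v\<in>S. \<forall>w\<in>S. v \<noteq> w \<longrightarrow> ?P (nb v \<inter> S) \<inter> ?P (nb w \<inter> S) = {}"
      using C4_free by fastforce
    show "\<forall>v\<in>S. finite (?P (nb v \<inter> S))" by (intro ballI fP) simp
  qed (rule fS)
  also have "\<dots> \<le> card (?P S)" by (rule card_mono) (use fS fP in auto)
  finally show ?thesis using fS by (simp add: cP)
qed

text \<open>
  Here \<open>b\<close> is the blue degree. Either \<open>S\<close> is small, or the count of red paths of length two is
  almost tight, and then every blue degree on \<open>S\<close> equals \<open>k - 2\<close> and the deficit is only \<open>|S|\<close>.
\<close>
lemma sum_deficit_le: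
  fixes b :: "'a \<Rightarrow> nat"
  assumes S: "S \<subseteq> V"
    and b: "\<And>v. v \<in> S \<Longrightarrow> b v + 2 \<le> k"
    and br: "\<And>v. v \<in> S \<Longrightarrow> card S \<le> b v + card (nb v \<inter> S) + 1"
    and f: "k \<le> (f + 1) ^ 2 + 1"
  shows "(\<Sum>v\<in>S. k - 1 - b v) \<le> max ((k - 1) * (k + f)) (k + f + 1)"
proof (cases "card S \<le> k + f")
  case True
  have "(\<Sum>v\<in>S. k - 1 - b v) \<le> card S * (k - 1)"
    using sum_bounded_above[of S "\<lambda>v. k - 1 - b v" "k - 1"] by simp
  also have "\<dots> \<le> (k - 1) * (k + f)" using True by (simp add: mult.commute)
  finally show ?thesis by simp
next
  case False
  define t where "t = card S - k"
  have s: "card S = k + t" and t: "t \<ge> f + 1" using False by (auto simp: t_def)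
  then have "S \<noteq> {}" by auto
  then have k: "k \<ge> 2" using b by fastforce
  \<comment> \<open>Since \<open>|S| = k + t\<close> and \<open>b v \<le> k - 2\<close>, the
    hypothesis \<open>br\<close> forces \<open>r v \<ge> t + 1\<close> on \<open>S\<close>. Hence
    \<open>j v\<close> is a true excess, without truncation.\<close>
  define r where "r v = card (nb v \<inter> S)" for v
  define j where "j v = r v - (t + 1)" for v
  have rj: "r v = t + 1 + j v" if "v \<in> S" for v
    using b[OF that] br[OF that] s by (simp add: j_def r_def)
  have "card S * (t * (t + 1)) + (\<Sum>v\<in>S. j v) = (\<Sum>v\<in>S. t * (t + 1) + j v)"
    by (simp add: sum.distrib)
  also have "\<dots> \<le> (\<Sum>v\<in>S. r v * (r v - 1))"
    by (rule sum_mono) (simp add: rj algebra_simps)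
  also have "\<dots> \<le> card S * (card S - 1)"
    unfolding r_def by (rule sum_cherries_le[OF S])
  also have "card S - 1 = (k - 1) + t" using s k by simp
  finally have main: "card S * (t * (t + 1)) + (\<Sum>v\<in>S. j v) \<le> card S * ((k - 1) + t)" .
  \<comment> \<open>The bound on \<open>f\<close> yields \<open>k - 1 \<le> t ^ 2\<close>, so the
    right side of \<open>main\<close> is at most its first summand and no room is left for any
    excess.\<close>
  have "(f + 1) ^ 2 \<le> t ^ 2" using t by (rule power_mono) simp
  then have kt: "k - 1 \<le> t ^ 2" using f by linarith
  then have "card S * ((k - 1) + t) \<le> card S * (t * (t + 1))"
    by (intro mult_left_mono) (simp_all add: power2_eq_square algebra_simps)
  with main have j0: "(\<Sum>v\<in>S. j v) = 0" by linarith
  \<comment> \<open>Dropping the excess and cancelling \<open>|S|\<close> gives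
    \<open>t ^ 2 \<le> k - 1\<close>, which caps \<open>t\<close> at \<open>f + 1\<close>.\<close>
  have "card S * (t * (t + 1)) \<le> card S * ((k - 1) + t)" using main by linarith
  then have "t * (t + 1) \<le> (k - 1) + t" using s k by simp
  then have "t ^ 2 \<le> k - 1" by (simp add: power2_eq_square)
  then have "t ^ 2 \<le> (f + 1) ^ 2" using f by linarith
  then have "t \<le> f + 1" by (simp only: power2_nat_le_eq_le)
  \<comment> \<open>Here \<open>br\<close> reads \<open>b v \<ge> k - 2 - j v\<close>.\<close>
  have "(\<Sum>v\<in>S. k - 1 - b v) \<le> (\<Sum>v\<in>S. 1 + j v)"
  proof (rule sum_mono)
    fix v assume v: "v \<in> S"
    show "k - 1 - b v \<le> 1 + j v" using br[OF v] rj[OF v] s by (simp add: r_def)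
  qed
  also have "\<dots> = card S" using j0 by (simp only: sum.distrib card_eq_sum)
  finally show ?thesis using s \<open>t \<le> f + 1\<close> by simp
qed

end

section \<open>The size of saturated graphs\<close>

text \<open>Joining two non-adjacent vertices closes a 4-cycle. A walk is enough here:
  \<open>u\<close> and \<open>v\<close> are distinct and non-adjacent and \<open>R\<close> is
  irreflexive, so its four vertices are distinct.\<close>

locale C4_saturated = C4_free_graph +
  assumes path: "u \<in> V \<Longrightarrow> v \<in> V \<Longrightarrow> u \<noteq> v \<Longrightarrow> \<not> R u v \<Longrightarrow> \<exists>p q. R u p \<and> R p q \<and> R q v"
begin

lemma deg_pos:
  assumes "v \<in> V" "card V \<ge> 2"
  shows "deg v \<ge> 1"
proof -
  obtain u where "u \<in> V" "u \<noteq> v"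
    by (metis assms(2) card_le_Suc0_iff_eq assms(1) finite_V not_less_eq_eq numeral_2_eq_2)
  then have "\<exists>w. w \<in> nb v" using path[of v u] assms by auto
  then show ?thesis by (metis One_nat_def Suc_leI card_gt_0_iff empty_iff finite_nb)
qed

text \<open>
  With \<open>y\<close> the neighbour of the leaf \<open>x\<close>, the paths of length three from \<open>x\<close> show that every other
  vertex has a neighbour in \<open>A = nb y - {x}\<close>. The set \<open>L\<close> of leaves outside \<open>A\<close> has at most two elements,
  because their neighbours lie in \<open>A\<close> and are pairwise adjacent.
\<close>
lemma sum_deg_leaf:
  assumes x: "x \<in> V" "deg x = 1" and n: "card V \<ge> 2"
  shows "3 * card V \<le> (\<Sum>v\<in>V. deg v) + 6"
proof -
  obtain y where y: "nb x = {y}" using x by (metis card_1_singletonE)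
  then have xy: "R x y" "R y x" "\<And>v. R x v \<Longrightarrow> v = y" using sym by (auto simp flip: mem_nb)
  then have yV: "y \<in> V" and ne: "x \<noteq> y" using in_V irrefl by blast+
  define A where "A = nb y - {x}"
  define C where "C = V - ({x, y} \<union> A)"
  have yA: "y \<notin> A" using irrefl by (auto simp: A_def)
  have AV: "A \<subseteq> V" using nb_subset by (auto simp: A_def)
  have fin: "finite A" "finite C" using finite_V AV finite_subset by (auto simp: C_def)
  have V: "V = {x, y} \<union> A \<union> C" using x yV AV by (auto simp: C_def)
  have disj: "A \<inter> C = {}" "{x, y} \<inter> A = {}" "({x, y} \<union> A) \<inter> C = {}" using yA by (auto simp: C_def A_def)
  have sumV: "sum f V = f x + f y + sum f A + sum f C" for f :: "'a \<Rightarrow> nat"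
    unfolding V using fin disj ne by (simp add: sum.union_disjoint del: Un_insert_left)
  have cardV: "card V = 2 + card A + card C" using sumV[of "\<lambda>_. 1"] by simp
  \<comment> \<open>The path must run \<open>x\<close>, \<open>y\<close>, \<open>q\<close>,
    \<open>v\<close>, and \<open>q \<noteq> x\<close> because \<open>v \<noteq> y\<close>. This
    covers \<open>v\<close> in \<open>A\<close> too, so each vertex of \<open>A\<close> has a
    neighbour in \<open>A\<close>.\<close>
  have par: "\<exists>a. a \<in> A \<and> R v a" if v: "v \<in> V" "v \<noteq> x" "v \<noteq> y" for v
  proof -
    from v xy obtain p q where "R x p" "R p q" "R q v" using path[of x v] x by blast
    with xy v have "R y q" "R v q" "q \<noteq> x" using sym by blast+
    then show ?thesis by (auto simp: A_def)
  qed
  have dy: "deg y = 1 + card A"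
  proof -
    have "nb y = insert x A" using xy(2) by (auto simp: A_def)
    moreover have "x \<notin> A" by (simp add: A_def)
    ultimately show ?thesis using fin by simp
  qed
  have dA: "deg a \<ge> 2 + card (nb a \<inter> C)" if a: "a \<in> A" for a
  proof -
    have "a \<in> V" "a \<noteq> x" "a \<noteq> y" using a AV disj by auto
    then obtain a' where a': "a' \<in> A" "R a a'" using par by blast
    have "{y, a'} \<union> (nb a \<inter> C) \<subseteq> nb a" using a a' sym by (auto simp: A_def)
    then have "card ({y, a'} \<union> (nb a \<inter> C)) \<le> deg a" by (intro card_mono) auto
    moreover have "card ({y, a'} \<union> (nb a \<inter> C)) = card {y, a'} + card (nb a \<inter> C)"
      using a' fin disj by (intro card_Un_disjoint) (auto simp: C_def)
    moreover have "y \<noteq> a'" using a' yA by auto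
    ultimately show ?thesis by simp
  qed
  have cC: "card (nb c \<inter> A) \<ge> 1" if c: "c \<in> C" for c
  proof -
    have "nb c \<inter> A \<noteq> {}" using par[of c] c by (auto simp: C_def)
    then show ?thesis using fin by (simp add: Suc_le_eq card_gt_0_iff)
  qed
  have "card C \<le> (\<Sum>c\<in>C. card (nb c \<inter> A))"
    using sum_bounded_below[of C 1, OF cC] by simp
  then have "2 * card A + card C \<le> (\<Sum>a\<in>A. 2 + card (nb a \<inter> C))"
    unfolding sum.distrib double_count[OF fin] by simp
  also have "\<dots> \<le> (\<Sum>a\<in>A. deg a)" by (rule sum_mono) (rule dA)
  finally have sA: "2 * card A + card C \<le> (\<Sum>a\<in>A. deg a)" .
  define L where "L = {c \<in> C. deg c = 1}"
  have fL: "finite L" using fin by (simp add: L_def)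
  have leaf: "\<exists>a \<in> A. \<forall>w. R c w \<longleftrightarrow> w = a" if "c \<in> L" for c
  proof -
    have "c \<in> V" "c \<noteq> x" "c \<noteq> y" and d: "deg c = 1" using that by (auto simp: L_def C_def)
    then obtain a where "a \<in> A" "R c a" using par by blast
    moreover obtain b where "nb c = {b}" using d by (metis card_1_singletonE)
    then have "\<forall>w. R c w \<longleftrightarrow> w = b" by (auto simp flip: mem_nb)
    ultimately show ?thesis by auto
  qed
  have LV: "L \<subseteq> V" by (auto simp: L_def C_def)
  have two: "R a a'"
    if c: "c \<in> L" "c' \<in> L" "c \<noteq> c'" and a: "\<forall>w. R c w \<longleftrightarrow> w = a" "\<forall>w. R c' w \<longleftrightarrow> w = a'"
      and A: "a \<in> A" "a' \<in> A" for c c' a a'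
  proof -
    \<comment> \<open>The only neighbour of a leaf in \<open>L\<close> lies in \<open>A\<close>,
      hence outside \<open>C\<close>. The path from \<open>c\<close> to \<open>c'\<close> therefore
      has inner vertices \<open>a\<close> and \<open>a'\<close>.\<close>
    have "\<not> R c c'" using a A c disj by (auto simp: L_def)
    then obtain p q where "R c p" "R p q" "R q c'" using path[of c c'] c LV by blast
    then show ?thesis using a sym by metis
  qed
  have cardL: "card L \<le> 2"
  proof (cases "L = {}")
    case False
    then obtain c0 where c0: "c0 \<in> L" by blast
    then obtain a0 where a0: "a0 \<in> A" "\<forall>w. R c0 w \<longleftrightarrow> w = a0" using leaf by blast
    \<comment> \<open>Three leaves in \<open>L\<close> would give a triangle \<open>a0\<close>,
      \<open>a\<close>, \<open>a'\<close> in \<open>A\<close>; then \<open>a0\<close> and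
      \<open>y\<close> are two common neighbours of \<open>a\<close> and \<open>a'\<close>.\<close>
    have "card (L - {c0}) \<le> 1"
    proof (rule card_le_1_if, rule ccontr)
      fix c c' assume c: "c \<in> L - {c0}" "c' \<in> L - {c0}" "c \<noteq> c'"
      then obtain a a' where a: "a \<in> A" "\<forall>w. R c w \<longleftrightarrow> w = a" "a' \<in> A" "\<forall>w. R c' w \<longleftrightarrow> w = a'"
        using leaf by (metis DiffD1)
      have "R a0 a" "R a0 a'" "R a a'"
        using two[of c0 c a0 a] two[of c0 c' a0 a'] two[of c c' a a'] a a0 c0 c by auto
      moreover have "R y a" "R y a'" "y \<noteq> a0" using a a0 yA by (auto simp: A_def)
      ultimately show False using C4_free[of a0 a a' y] irrefl by metis
    qed
    then show ?thesis using c0 fL by (simp add: card_Diff_singleton_if)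
  qed simp
  have "2 * card C = (\<Sum>c\<in>C. 2)" by simp
  also have "\<dots> \<le> (\<Sum>c\<in>C. deg c + (if c \<in> L then 1 else 0))"
  proof (rule sum_mono)
    fix c assume "c \<in> C"
    then show "2 \<le> deg c + (if c \<in> L then 1 else 0)"
      using deg_pos[of c] n by (auto simp: L_def C_def)
  qed
  also have "\<dots> = (\<Sum>c\<in>C. deg c) + card L"
    using fin by (simp add: sum.distrib L_def flip: sum.inter_filter)
  finally have "2 * card C \<le> (\<Sum>c\<in>C. deg c) + 2" using cardL by linarith
  \<comment> \<open>In the order \<open>x\<close>, \<open>y\<close>, \<open>A\<close>,
    \<open>C\<close> the total is at least
    \<open>1 + (1 + |A|) + (2|A| + |C|) + (2|C| - 2) = 3(|V| - 2)\<close>.\<close>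
  then show ?thesis using sumV[of deg] cardV sA dy x by simp
qed

text \<open>
  The paths of length three from \<open>x\<close> show that every vertex outside the neighbourhood \<open>D\<close> of
  \<open>{y, z}\<close> has a neighbour in \<open>D\<close>, and if \<open>y\<close>, \<open>z\<close> are not adjacent then so does every vertex of \<open>D\<close>.
  If they are adjacent, the set \<open>I\<close> of isolated vertices of \<open>D\<close> costs one degree each. Two such
  vertices on the same side are joined by a path through \<open>C\<close>, whose inner vertices have degree at
  least 3 since vertices of degree 2 lie in triangles; this surplus pays for all of \<open>I\<close> but two.
\<close>
lemma sum_deg_2:
  assumes x: "x \<in> V" "nb x = {y, z}" "y \<noteq> z" and min2: "\<And>v. v \<in> V \<Longrightarrow> deg v \<ge> 2"
  and cases: "\<not> R y z \<or> (\<forall>v p q. nb v = {p, q} \<longrightarrow> p \<noteq> q \<longrightarrow> R p q)"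
  shows "3 * card V \<le> (\<Sum>v\<in>V. deg v) + 6"
proof -
  have xy: "R x y" "R x z" "R y x" "R z x" "\<And>v. R x v \<Longrightarrow> v = y \<or> v = z"
    using x sym by (auto simp flip: mem_nb)
  have yzV: "y \<in> V" "z \<in> V" and ne: "x \<noteq> y" "x \<noteq> z" using in_V irrefl xy by blast+
  define A where "A = nb y - {x, z}"
  define B where "B = nb z - {x, y}"
  define D where "D = A \<union> B"
  define C where "C = V - ({x, y, z} \<union> D)"
  have common: "v = x" if "R v y" "R v z" for v using that C4_free[of v y z x] xy x by blast
  have AB: "A \<inter> B = {}" using common sym by (auto simp: A_def B_def)
  have DV: "D \<subseteq> V" using nb_subset by (auto simp: D_def A_def B_def)
  have fAB: "finite A" "finite B" by (simp_all add: A_def B_def)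
  have fin: "finite D" "finite C" using finite_V fAB by (auto simp: C_def D_def)
  have V: "V = {x, y, z} \<union> D \<union> C" using x yzV DV by (auto simp: C_def)
  have disj: "{x, y, z} \<inter> D = {}" "({x, y, z} \<union> D) \<inter> C = {}"
    using irrefl by (auto simp: C_def A_def B_def D_def)
  have sumV: "sum f V = f x + f y + f z + sum f D + sum f C" for f :: "'a \<Rightarrow> nat"
    unfolding V using fin disj ne x(3) by (simp add: sum.union_disjoint del: Un_insert_left)
  have cardV: "card V = 3 + card D + card C" using sumV[of "\<lambda>_. 1"] by simp
  have cardD: "card D = card A + card B" using AB fAB by (simp add: D_def card_Un_disjoint)
  \<comment> \<open>The path from \<open>x\<close> leaves through \<open>y\<close> or
    \<open>z\<close>, and \<open>d\<close> is its next vertex. If \<open>y\<close> and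
    \<open>z\<close> are adjacent, \<open>d\<close> may be one of them; only then can a vertex of
    \<open>D\<close> lack a neighbour in \<open>D\<close>.\<close>
  have par: "\<exists>d. R v d \<and> (R y d \<or> R z d) \<and> d \<noteq> x" if v: "v \<in> V" "v \<notin> {x, y, z}" for v
  proof -
    have "\<not> R x v" using xy v by auto
    then obtain p q where "R x p" "R p q" "R q v" using path[of x v] x v by blast
    moreover from this have "q \<noteq> x" using \<open>\<not> R x v\<close> by auto
    ultimately show ?thesis using xy sym by blast
  qed
  have parC: "card (nb c \<inter> D) \<ge> 1" if c: "c \<in> C" for c
  proof -
    have cc: "c \<in> V" "c \<notin> {x, y, z}" "\<not> R y c" "\<not> R z c"
      using c by (auto simp: C_def A_def B_def D_def)
    obtain d where "R c d" "R y d \<or> R z d" "d \<noteq> x" using par[OF cc(1,2)] by blast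
    then have "d \<in> nb c \<inter> D" using cc sym by (auto simp: A_def B_def D_def)
    then show ?thesis by (metis One_nat_def Suc_leI card_gt_0_iff empty_iff finite_Int finite_nb)
  qed
  have dD: "deg d = 1 + card (nb d \<inter> D) + card (nb d \<inter> C)" if d: "d \<in> D" for d
  proof -
    \<comment> \<open>A vertex of \<open>D\<close> has exactly one neighbour among \<open>x\<close>,
      \<open>y\<close>, \<open>z\<close>: two of them as \<open>y\<close>, \<open>z\<close> would
      make it \<open>x\<close>, and \<open>x\<close> has no neighbour in \<open>D\<close>.\<close>
    define u where "u = (if d \<in> A then y else z)"
    have u: "R d w \<and> w \<in> {x, y, z} \<longleftrightarrow> w = u" for w
    proof (cases "d \<in> A")
      case True
      then have "R d y" "d \<noteq> x" "d \<noteq> z" "d \<noteq> y" using irrefl by (auto simp: A_def intro: sym)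
      then show ?thesis using common[of d] xy(5)[of d] sym[of d x] True by (auto simp: u_def)
    next
      case False
      then have "R d z" "d \<noteq> x" "d \<noteq> z" "d \<noteq> y" using irrefl d by (auto simp: D_def B_def intro: sym)
      then show ?thesis using common[of d] xy(5)[of d] sym[of d x] False by (auto simp: u_def)
    qed
    have "w \<in> nb d \<longleftrightarrow> w \<in> insert u (nb d \<inter> D \<union> nb d \<inter> C)" for w
    proof -
      have "R d w \<Longrightarrow> w \<in> {x, y, z} \<or> w \<in> D \<or> w \<in> C" using nb_subset[of d] V mem_nb by blast
      then show ?thesis using u[of w] by auto
    qed
    then have "nb d = insert u (nb d \<inter> D \<union> nb d \<inter> C)" by blast
    moreover have "u \<notin> nb d \<inter> D \<union> nb d \<inter> C" using disj u[of u] by blast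
    moreover have "card (nb d \<inter> D \<union> nb d \<inter> C) = card (nb d \<inter> D) + card (nb d \<inter> C)"
      using fin disj by (intro card_Un_disjoint) auto
    ultimately show ?thesis using fin by (metis add.assoc card_insert_disjoint finite_Int finite_Un plus_1_eq_Suc)
  qed
  define I where "I = {d \<in> D. nb d \<inter> D = {}}"
  have "card D = (\<Sum>d\<in>D. 1)" by simp
  also have "\<dots> \<le> (\<Sum>d\<in>D. card (nb d \<inter> D) + (if nb d \<inter> D = {} then 1 else 0))"
    by (rule sum_mono) (auto simp: Suc_le_eq card_gt_0_iff)
  also have "\<dots> = (\<Sum>d\<in>D. card (nb d \<inter> D)) + card I"
    using fin by (simp add: sum.distrib I_def flip: sum.inter_filter)
  finally have "card D \<le> (\<Sum>d\<in>D. card (nb d \<inter> D)) + card I" .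
  moreover have "(\<Sum>d\<in>D. deg d) = (\<Sum>d\<in>D. 1 + card (nb d \<inter> D) + card (nb d \<inter> C))"
    by (rule sum.cong[OF refl dD])
  then have "(\<Sum>d\<in>D. deg d) = card D + (\<Sum>d\<in>D. card (nb d \<inter> D)) + (\<Sum>d\<in>D. card (nb d \<inter> C))"
    by (simp only: sum.distrib card_eq_sum)
  ultimately have sD: "(\<Sum>d\<in>D. deg d) + card I \<ge> 2 * card D + (\<Sum>c\<in>C. card (nb c \<inter> D))"
    using double_count[OF fin] by linarith
  have CV: "C \<subseteq> V" by (auto simp: C_def)
  show ?thesis
  proof (cases "R y z")
    case False
    have "I = {}"
    proof (rule ccontr)
      assume "I \<noteq> {}"
      then obtain v where v: "v \<in> D" "nb v \<inter> D = {}" by (auto simp: I_def)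
      then have "v \<in> V" "v \<notin> {x, y, z}" using DV disj by auto
      from par[OF this] obtain d where "R v d" "R y d \<or> R z d" "d \<noteq> x" by blast
      then have "d \<in> nb v \<inter> D" using False sym by (auto simp: D_def A_def B_def)
      then show False using v by blast
    qed
    moreover have "deg y = 1 + card A" "deg z = 1 + card B"
    proof -
      have "nb y = insert x A" "nb z = insert x B" using xy(3,4) False sym[of z y] by (auto simp: A_def B_def)
      moreover have "x \<notin> A" "x \<notin> B" by (simp_all add: A_def B_def)
      ultimately show "deg y = 1 + card A" "deg z = 1 + card B" using fAB by simp_all
    qed
    moreover have "card C \<le> (\<Sum>c\<in>C. card (nb c \<inter> D))"
      using sum_bounded_below[of C 1, OF parC] by simp
    moreover have "2 * card C \<le> (\<Sum>c\<in>C. deg c)"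
      using sum_bounded_below[of C 2 deg] min2 CV by (simp add: subset_iff mult.commute)
    \<comment> \<open>The total is at least
      \<open>2 + (1 + |A|) + (1 + |B|) + (2|D| + |C|) + 2|C| = 3|V| - 5\<close>.\<close>
    ultimately show ?thesis using sumV[of deg] cardV sD cardD x by simp
  next
    case True
    then have tri: "R p q" if "nb v = {p, q}" "p \<noteq> q" for v p q using cases that by blast
    have dyz: "deg y = 2 + card A" "deg z = 2 + card B"
    proof -
      have "nb y = insert x (insert z A)" "nb z = insert x (insert y B)"
        using xy(3,4) True sym[of y z] by (auto simp: A_def B_def)
      moreover have "x \<notin> A" "z \<notin> A" "x \<notin> B" "y \<notin> B" by (simp_all add: A_def B_def)
      ultimately show "deg y = 2 + card A" "deg z = 2 + card B" using fAB ne by simp_all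
    qed
    define J where "J = {d \<in> I. \<exists>c \<in> C. R d c \<and> deg c \<ge> 3}"
    \<comment> \<open>Stated for a side \<open>Z\<close> with apex \<open>u\<close>, to be used for
      \<open>A\<close> with \<open>y\<close> and for \<open>B\<close> with \<open>z\<close>.\<close>
    have one: "card ((I - J) \<inter> Z) \<le> 1"
      if u: "\<And>d. d \<in> Z \<Longrightarrow> R d u" "\<And>c. c \<in> C \<Longrightarrow> \<not> R c u"
        and Z: "\<And>d w. d \<in> Z \<Longrightarrow> R d w \<Longrightarrow> w = u \<or> w \<in> D \<union> C" for Z u
    proof (rule card_le_1_if, rule ccontr)
      fix a a' assume a: "a \<in> (I - J) \<inter> Z" "a' \<in> (I - J) \<inter> Z" "a \<noteq> a'"
      have ua: "R a u" "R a' u" using a u by auto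
      have N: "w = u \<or> w \<in> C" if "R a w \<or> R a' w" for w
      proof -
        have "w \<notin> D" using that a by (auto simp: I_def simp flip: mem_nb)
        then show ?thesis using that Z[of a w] Z[of a' w] a by blast
      qed
      have "a \<in> V" "a' \<in> V" "\<not> R a a'" using a DV by (auto simp: I_def)
      then obtain p q where pq: "R a p" "R p q" "R q a'" using path a by blast
      have "p \<noteq> u" "q \<noteq> u" using N[of p] N[of q] pq sym irrefl u(2) by blast+
      then have pC: "p \<in> C" using N pq by blast
      \<comment> \<open>If \<open>p\<close> had degree 2, its neighbours \<open>a\<close> and
        \<open>q\<close> would be adjacent, and \<open>q\<close> and \<open>u\<close> would be two
        common neighbours of \<open>a\<close> and \<open>a'\<close>. Degree at least 3 puts
        \<open>a\<close> into \<open>J\<close>.\<close>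
      have "deg p \<ge> 3"
      proof (rule ccontr)
        assume "\<not> deg p \<ge> 3"
        then have d2: "deg p = 2" using min2[of p] pC CV by force
        have aq: "a \<noteq> q" using pq \<open>\<not> R a a'\<close> by auto
        have "{a, q} = nb p" using pq sym aq d2 by (intro card_subset_eq) auto
        then have "R a q" using tri[of p a q] aq by simp
        then show False using C4_free[of q a a' u] ua pq sym \<open>q \<noteq> u\<close> a(3) by blast
      qed
      then show False using a pq pC by (auto simp: J_def)
    qed
    have CD: "R d w \<Longrightarrow> d \<in> D \<Longrightarrow> w \<in> {x, y, z} \<union> D \<union> C" for d w
      using nb_subset[of d] V by auto
    have sub: "(I - J) = ((I - J) \<inter> A) \<union> ((I - J) \<inter> B)" by (auto simp: I_def D_def)
    have "card ((I - J) \<inter> A) \<le> 1"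
    proof (rule one[of A y])
      fix d w assume d: "d \<in> A" "R d w"
      then have "w \<noteq> x" "w \<noteq> z" using xy(5)[of d] common[of d] sym irrefl by (auto simp: A_def)
      then show "w = y \<or> w \<in> D \<union> C" using CD[of d w] d by (auto simp: D_def)
    qed (use sym in \<open>auto simp: A_def C_def D_def\<close>)
    moreover have "card ((I - J) \<inter> B) \<le> 1"
    proof (rule one[of B z])
      fix d w assume d: "d \<in> B" "R d w"
      then have "w \<noteq> x" "w \<noteq> y" using xy(5)[of d] common[of d] sym irrefl by (auto simp: B_def)
      then show "w = z \<or> w \<in> D \<union> C" using CD[of d w] d by (auto simp: D_def)
    qed (use sym in \<open>auto simp: B_def C_def D_def\<close>)
    ultimately have "card (I - J) \<le> 2" using card_Un_le[of "(I - J) \<inter> A" "(I - J) \<inter> B"] sub by simp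
    moreover have "J \<subseteq> I" "finite I" using fin by (auto simp: I_def J_def)
    ultimately have IJ: "card I \<le> card J + 2" by (simp add: card_Diff_subset finite_subset)
    define C3 where "C3 = {c \<in> C. deg c \<ge> 3}"
    have "J \<subseteq> (\<Union>c\<in>C3. nb c \<inter> D)" using sym by (auto simp: J_def I_def C3_def)
    then have "card J \<le> card (\<Union>c\<in>C3. nb c \<inter> D)" using fin by (intro card_mono) (auto simp: C3_def)
    also have "\<dots> \<le> (\<Sum>c\<in>C3. card (nb c \<inter> D))" using fin by (intro card_UN_le) (auto simp: C3_def)
    also have "\<dots> = (\<Sum>c\<in>C. if deg c \<ge> 3 then card (nb c \<inter> D) else 0)"
      using fin by (simp add: C3_def sum.inter_filter)
    finally have "card J + 3 * card C \<le> (\<Sum>c\<in>C. (if deg c \<ge> 3 then card (nb c \<inter> D) else 0) + 3)"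
      by (simp add: sum.distrib)
    \<comment> \<open>A vertex of degree 2 reaches 3 with the help of an edge to \<open>D\<close>;
      one of degree at least 3 does so alone, and its edges to \<open>D\<close> remain to pay for
      \<open>J\<close>.\<close>
    also have "\<dots> \<le> (\<Sum>c\<in>C. deg c + card (nb c \<inter> D))"
    proof (rule sum_mono)
      fix c assume "c \<in> C"
      then show "(if deg c \<ge> 3 then card (nb c \<inter> D) else 0) + 3 \<le> deg c + card (nb c \<inter> D)"
        using parC[of c] min2[of c] CV by auto
    qed
    finally have "card J + 3 * card C \<le> (\<Sum>c\<in>C. deg c) + (\<Sum>c\<in>C. card (nb c \<inter> D))"
      by (simp add: sum.distrib)
    then show ?thesis using sumV[of deg] cardV sD cardD x dyz IJ by simp
  qed
qed

text \<open>Minimum degree 1 is the leaf case and minimum degree at least 3 is immediate. For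
  minimum degree 2, a degree-2 vertex with non-adjacent neighbours is preferred as base point; if
  there is none, all degree-2 vertices lie in triangles.\<close>

lemma sum_deg_saturated:
  assumes n: "card V \<ge> 2"
  shows "3 * card V \<le> (\<Sum>v\<in>V. deg v) + 6"
proof -
  consider (leaf) x where "x \<in> V" "deg x = 1"
    | (open2) x y z where "\<And>v. v \<in> V \<Longrightarrow> deg v \<ge> 2" "x \<in> V" "nb x = {y, z}" "y \<noteq> z" "\<not> R y z"
    | (tri) x y z where "\<And>v. v \<in> V \<Longrightarrow> deg v \<ge> 2" "x \<in> V" "nb x = {y, z}" "y \<noteq> z"
        "\<forall>v p q. nb v = {p, q} \<longrightarrow> p \<noteq> q \<longrightarrow> R p q"
    | (big) "\<And>v. v \<in> V \<Longrightarrow> deg v \<ge> 3"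
  proof (cases "\<exists>x\<in>V. deg x = 1")
    case False
    then have 2: "deg v \<ge> 2" if "v \<in> V" for v using deg_pos[OF that n] that by force
    show ?thesis
    proof (cases "\<exists>x\<in>V. deg x = 2")
      case True
      then obtain x y z where x: "x \<in> V" "nb x = {y, z}" "y \<noteq> z" by (auto simp: card_2_iff)
      show ?thesis
      proof (cases "\<forall>v p q. nb v = {p, q} \<longrightarrow> p \<noteq> q \<longrightarrow> R p q")
        case True
        then show ?thesis using tri[OF 2 x] by blast
      next
        case False
        then obtain v p q where v: "nb v = {p, q}" "p \<noteq> q" "\<not> R p q" by blast
        then have "R v p" by (simp flip: mem_nb)
        then have "v \<in> V" by (rule in_V)
        then show ?thesis using open2[OF 2 _ v] by blast
      qed
    next
      case False
      have "deg v \<ge> 3" if "v \<in> V" for v using 2[OF that] False that by force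
      then show ?thesis by (rule big)
    qed
  qed (use leaf in blast)
  then show ?thesis
  proof cases
    case leaf
    then show ?thesis by (rule sum_deg_leaf[OF _ _ n])
  next
    case open2
    then show ?thesis using sum_deg_2 by blast
  next
    case tri
    then show ?thesis using sum_deg_2[OF tri(2-4)] by blast
  next
    case big
    have "card V * 3 \<le> (\<Sum>v\<in>V. deg v)" using sum_bounded_below[of V 3 deg, OF big] by simp
    then show ?thesis by simp
  qed
qed

end
section \<open>Colourings\<close>

lemma sgraph_edges:
  assumes "finite V" "E \<subseteq> pairs_of V"
  shows "sgraph V (\<lambda>u v. {u, v} \<in> E)"
proof
  show "{v, u} \<in> E" if "{u, v} \<in> E" for u v using that by (simp add: insert_commute)
  show "{v, v} \<notin> E" for v using assms by (auto simp: pairs_of_def)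
  show "u \<in> V" if "{u, v} \<in> E" for u v using that assms by (auto simp: pairs_of_def)
qed (rule assms)

lemma edge_neq: "E \<subseteq> pairs_of V \<Longrightarrow> {u, v} \<in> E \<Longrightarrow> u \<noteq> v"
  by (auto simp: pairs_of_def)

section \<open>Degrees and copies of \<open>C4\<close> and stars, in terms of edge sets\<close>

definition edeg :: "'a set set \<Rightarrow> 'a \<Rightarrow> nat" where
  "edeg E v = card {w. {v, w} \<in> E}"

lemma finite_edges: "finite V \<Longrightarrow> E \<subseteq> pairs_of V \<Longrightarrow> finite E"
  by (rule finite_subset[of _ "Pow V"]) (auto simp: pairs_of_def)

lemma finite_edge_nbs: "finite V \<Longrightarrow> E \<subseteq> pairs_of V \<Longrightarrow> finite {w. {v, w} \<in> E}"
  by (rule finite_subset[of _ V]) (auto simp: pairs_of_def)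

lemma sum_edeg:
  assumes "finite V" "E \<subseteq> pairs_of V"
  shows "(\<Sum>v\<in>V. edeg E v) = 2 * card E"
proof -
  have "edeg E v = card {e \<in> E. v \<in> e}" for v
    unfolding edeg_def
  proof (rule bij_betw_same_card[of "\<lambda>w. {v, w}"], rule bij_betw_imageI)
    show "inj_on (\<lambda>w. {v, w}) {w. {v, w} \<in> E}" by (auto simp: inj_on_def doubleton_eq_iff)
    show "(\<lambda>w. {v, w}) ` {w. {v, w} \<in> E} = {e \<in> E. v \<in> e}"
    proof (intro equalityI subsetI)
      fix e assume e: "e \<in> {e \<in> E. v \<in> e}"
      then have "card e = 2" using assms by (auto simp: pairs_of_def)
      then obtain x y where "e = {x, y}" by (auto simp: card_2_iff)
      then show "e \<in> (\<lambda>w. {v, w}) ` {w. {v, w} \<in> E}" using e by (auto simp: insert_commute)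
    qed auto
  qed
  moreover have "(\<Sum>v\<in>V. card {e \<in> E. v \<in> e}) = 2 * card E"
  proof (rule sum_multicount)
    show "\<forall>e\<in>E. card {v \<in> V. v \<in> e} = 2"
    proof
      fix e assume "e \<in> E"
      then have "e \<subseteq> V" "card e = 2" using assms by (auto simp: pairs_of_def)
      moreover from this have "{v \<in> V. v \<in> e} = e" by auto
      ultimately show "card {v \<in> V. v \<in> e} = 2" by simp
    qed
  qed (use assms finite_edges in auto)
  ultimately show ?thesis by simp
qed

text \<open>Consecutive vertices differ because all edges are pairs, so injectivity only needs the
  two diagonals.\<close>

lemma contains_C4_iff:
  assumes "E \<subseteq> pairs_of V"
  shows "contains_copy (V, E) C4 \<longleftrightarrow>
    (\<exists>a b c d. {a, b} \<in> E \<and> {b, c} \<in> E \<and> {c, d} \<in> E \<and> {d, a} \<in> E \<and> a \<noteq> c \<and> b \<noteq> d)"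
    (is "?L \<longleftrightarrow> ?R")
proof
  assume ?L
  then obtain f :: "nat \<Rightarrow> 'a" where "inj_on f {0, 1, 2, 3}"
    and "{f 0, f 1} \<in> E" "{f 1, f 2} \<in> E" "{f 2, f 3} \<in> E" "{f 3, f 0} \<in> E"
    by (auto simp: contains_copy_def verts_def edges_def C4_def)
  moreover from this(1) have "f 0 \<noteq> f 2" "f 1 \<noteq> f 3" by (auto dest: inj_onD)
  ultimately show ?R by blast
next
  assume ?R
  then obtain a b c d where *: "{a, b} \<in> E" "{b, c} \<in> E" "{c, d} \<in> E" "{d, a} \<in> E" "a \<noteq> c" "b \<noteq> d"
    by blast
  define f where "f = (\<lambda>i::nat. if i = 0 then a else if i = 1 then b else if i = 2 then c else d)"
  have "a \<noteq> b" "b \<noteq> c" "c \<noteq> d" "d \<noteq> a" using * edge_neq[OF assms] by blast+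
  moreover have "a \<in> V" "b \<in> V" "c \<in> V" "d \<in> V" using * assms by (auto simp: pairs_of_def)
  ultimately show ?L unfolding contains_copy_def
    using * by (intro exI[of _ f]) (auto simp: insert_commute verts_def edges_def C4_def f_def inj_on_def)
qed

lemma contains_star_iff:
  assumes "finite V" "E \<subseteq> pairs_of V" "k \<ge> 1"
  shows "contains_copy (V, E) (star k) \<longleftrightarrow> (\<exists>v. edeg E v \<ge> k)"
    (is "?L \<longleftrightarrow> ?R")
proof
  assume ?L
  then obtain f :: "nat \<Rightarrow> 'a" where f: "inj_on f {0..k}"
    and fE: "\<forall>e\<in>{{0, i} |i. i \<in> {1..k}}. f ` e \<in> E"
    by (auto simp only: contains_copy_def verts_def edges_def star_def fst_conv snd_conv)
  have fE: "{f 0, f i} \<in> E" if "i \<in> {1..k}" for i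
    using bspec[OF fE, of "{0, i}"] that by auto
  have "card (f ` {1..k}) = k" using inj_on_subset[OF f, of "{1..k}"] by (subst card_image) auto
  moreover have "card (f ` {1..k}) \<le> edeg E (f 0)" unfolding edeg_def
    using fE by (intro card_mono finite_edge_nbs[OF assms(1,2)]) auto
  ultimately show ?R by auto
next
  assume ?R
  then obtain v where "card {w. {v, w} \<in> E} \<ge> k" by (auto simp: edeg_def)
  then obtain T where T: "T \<subseteq> {w. {v, w} \<in> E}" "card T = k" "finite T"
    by (meson obtain_subset_with_card_n)
  then obtain g where g: "bij_betw g {1..k} T"
    using finite_same_card_bij[of "{1..k}" T] by auto
  define f where "f i = (if i = 0 then v else g i)" for i
  have gT: "g i \<in> T" if "i \<in> {1..k}" for i using g that by (auto simp: bij_betw_def)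
  have "v \<notin> T" using T edge_neq[OF assms(2)] by blast
  have "inj_on f {0..k}"
  proof (rule inj_onI)
    fix i j assume ij: "i \<in> {0..k}" "j \<in> {0..k}" "f i = f j"
    have pos: "f l \<noteq> v" if "l \<in> {0..k}" "l \<noteq> 0" for l
      using gT[of l] that \<open>v \<notin> T\<close> by (auto simp: f_def)
    show "i = j"
    proof (cases "i = 0 \<or> j = 0")
      case True
      then show ?thesis using pos ij by (metis f_def)
    next
      case False
      then have "g i = g j" "i \<in> {1..k}" "j \<in> {1..k}" using ij by (auto simp: f_def)
      then show ?thesis using g by (meson bij_betw_def inj_onD)
    qed
  qed
  moreover have e: "{v, g i} \<in> E" if "i \<in> {1..k}" for i using gT[OF that] T by auto
  moreover have "f ` {0..k} \<subseteq> V"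
  proof
    fix x assume "x \<in> f ` {0..k}"
    then obtain i where "i \<le> k" "x = f i" by auto
    \<comment> \<open>The centre lies in \<open>V\<close> as an end of the edge to leaf
      \<open>g 1\<close>, which exists because \<open>k \<ge> 1\<close>.\<close>
    then show "x \<in> V" using e[of i] e[of 1] assms by (cases "i = 0") (auto simp: f_def pairs_of_def)
  qed
  ultimately show ?L unfolding contains_copy_def
    by (intro exI[of _ f]) (auto simp: verts_def edges_def star_def f_def insert_commute)
qed

text \<open>Every new 4-cycle uses the added edge, and deleting that edge from the cycle leaves the
  path.\<close>

lemma path_of_new_C4:
  assumes E: "E \<subseteq> pairs_of V" and uv: "{u, v} \<in> pairs_of V"
    and "\<not> contains_copy (V, E) C4" and "contains_copy (V, insert {u, v} E) C4"
  shows "\<exists>p q. {u, p} \<in> E \<and> {p, q} \<in> E \<and> {q, v} \<in> E"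
proof -
  have E': "insert {u, v} E \<subseteq> pairs_of V" using E uv by simp
  obtain a b c d where in': "{a, b} \<in> insert {u, v} E" "{b, c} \<in> insert {u, v} E"
      "{c, d} \<in> insert {u, v} E" "{d, a} \<in> insert {u, v} E" and ne: "a \<noteq> c" "b \<noteq> d"
    using assms(4)[unfolded contains_C4_iff[OF E']] by auto
  have some: "\<not> ({a, b} \<in> E \<and> {b, c} \<in> E \<and> {c, d} \<in> E \<and> {d, a} \<in> E)"
    using assms(3)[unfolded contains_C4_iff[OF E]] ne by metis
  \<comment> \<open>The cycle is rotated so that the added edge comes first; the other three edges
    differ from it and so lie in \<open>E\<close>.\<close>
  have path: ?thesis
    if "{a, b} = {u, v}" "{b, c} \<in> insert {u, v} E" "{c, d} \<in> insert {u, v} E" "{d, a} \<in> insert {u, v} E"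
      "a \<noteq> c" "b \<noteq> d" for a b c d
  proof -
    have ne': "a \<noteq> b" "b \<noteq> c" "c \<noteq> d" "d \<noteq> a"
      using edge_neq[OF E', of a b] edge_neq[OF E', of b c] edge_neq[OF E', of c d]
        edge_neq[OF E', of d a] that by blast+
    then have "{b, c} \<in> E" "{c, d} \<in> E" "{d, a} \<in> E"
      using that(2-) unfolding that(1)[symmetric] by (auto simp: doubleton_eq_iff)
    moreover from this have "{a, d} \<in> E" "{d, c} \<in> E" "{c, b} \<in> E" by (simp_all add: insert_commute)
    moreover have "a = u \<and> b = v \<or> a = v \<and> b = u" using that(1) by (auto simp: doubleton_eq_iff)
    ultimately show ?thesis by blast
  qed
  have "{a, b} = {u, v} \<or> {b, c} = {u, v} \<or> {c, d} = {u, v} \<or> {d, a} = {u, v}"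
    using some in' unfolding insert_iff by argo
  then consider "{a, b} = {u, v}" | "{b, c} = {u, v}" | "{c, d} = {u, v}" | "{d, a} = {u, v}"
    by argo
  then show ?thesis
    using path[of a b c d] path[of b c d a] path[of c d a b] path[of d a b c] in' ne by cases auto
qed

lemma critical_colouring_iff:
  assumes "simple_graph G" "k \<ge> 1"
  shows "critical_colouring k G c \<longleftrightarrow>
    \<not> contains_copy (verts G, {e \<in> edges G. c e = Red}) C4 \<and>
    (\<forall>v. edeg {e \<in> edges G. c e = Blue} v < k)"
proof -
  have "{e \<in> edges G. c e = Blue} \<subseteq> pairs_of (verts G)" "finite (verts G)"
    using assms by (auto simp: simple_graph_def)
  from contains_star_iff[OF this(2,1) assms(2)] show ?thesis
    by (auto simp: critical_colouring_def colour_class_def not_le)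
qed

lemma edeg_mono:
  assumes "finite V" "E \<subseteq> E'" "E' \<subseteq> pairs_of V"
  shows "edeg E v \<le> edeg E' v"
  unfolding edeg_def using assms by (intro card_mono finite_edge_nbs[of V]) auto

lemma edeg_insert_le:
  assumes "finite V" "E \<subseteq> pairs_of V" "u \<noteq> v"
  shows "edeg (insert {u, v} E) w \<le> edeg E w + (if w \<in> {u, v} then 1 else 0)"
proof -
  let ?N = "{x. {w, x} \<in> E}"
  have fin: "finite ?N" by (rule finite_edge_nbs[OF assms(1,2)])
  let ?X = "if w = u then {v} else if w = v then {u} else {}"
  have "{x. {w, x} \<in> insert {u, v} E} \<subseteq> ?N \<union> ?X"
    by (auto simp: doubleton_eq_iff)
  then have "edeg (insert {u, v} E) w \<le> card (?N \<union> ?X)"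
    unfolding edeg_def using fin by (intro card_mono) auto
  also have "\<dots> \<le> card ?N + card ?X" by (rule card_Un_le)
  finally show ?thesis using assms(3) by (simp add: edeg_def split: if_splits)
qed

section \<open>The edge bound for co-critical graphs\<close>

theorem theorem3p1:
  fixes k n :: nat and G :: "'a graph"
  assumes "k \<ge> 2"
    and "int n \<ge> int k + \<lfloor>sqrt (real k - 1)\<rfloor> + 2"
    and "simple_graph G"
    and "card (verts G) = n"
    and "co_critical k G"
  shows "real (card (edges G)) \<ge>
    (real k + 2) * real n / 2 - 3
      - (real k - 1) * (real k + of_int \<lfloor>sqrt (real k - 2)\<rfloor>) / 2"
proof -
  define V where "V = verts G"
  define E where "E = edges G"
  have finV: "finite V" and EV: "E \<subseteq> pairs_of V" and cardV: "card V = n"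
    using assms(3,4) by (auto simp: simple_graph_def V_def E_def)
  have finE: "finite E" using finV EV by (rule finite_edges)
  have k1: "k \<ge> 1" using assms(1) by simp
  have "\<lfloor>sqrt (real k - 1)\<rfloor> \<ge> 0" using assms(1) by simp
  then have n2: "n \<ge> 2" using assms(2) by linarith
  define crit where "crit c \<longleftrightarrow> critical_colouring k G c" for c
  define cls where "cls c x = {e \<in> E. c e = x}" for c :: "'a set \<Rightarrow> colour" and x
  have crit: "crit c \<longleftrightarrow> \<not> contains_copy (V, cls c Red) C4 \<and> (\<forall>v. edeg (cls c Blue) v < k)" for c
    unfolding crit_def cls_def V_def E_def using critical_colouring_iff[OF assms(3) k1] .
  have clsV: "cls c x \<subseteq> pairs_of V" for c x using EV by (auto simp: cls_def)
  have "\<exists>c. crit c \<and> (\<forall>c'. crit c' \<longrightarrow> card (cls c' Red) \<le> card (cls c Red))"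
  proof -
    obtain c0 where c0: "crit c0" using assms(5) by (auto simp: crit_def co_critical_def)
    have bd: "\<forall>c. crit c \<longrightarrow> card (cls c Red) < card E + 1"
      using finE by (auto simp: cls_def less_Suc_eq_le intro!: card_mono)
    show ?thesis using ex_has_greatest_nat[OF c0 bd] by blast
  qed
  then obtain c where c: "crit c"
    and cmax: "\<And>c'. crit c' \<Longrightarrow> card (cls c' Red) \<le> card (cls c Red)" by blast
  define Rd where "Rd = cls c Red"
  define Bl where "Bl = cls c Blue"
  have noC4: "\<not> contains_copy (V, Rd) C4" and blue: "\<And>v. edeg Bl v < k"
    using c by (auto simp: crit Rd_def Bl_def)
  have RdV: "Rd \<subseteq> pairs_of V" and BlV: "Bl \<subseteq> pairs_of V" using clsV by (auto simp: Rd_def Bl_def)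
  have E_eq: "E = Rd \<union> Bl" using colour.exhaust by (auto simp: Rd_def Bl_def cls_def)
  have disj: "Rd \<inter> Bl = {}" by (auto simp: Rd_def Bl_def cls_def)
  \<comment> \<open>Co-criticality for an arbitrary colouring \<open>c'\<close> of the enlarged
    graph. It is applied to \<open>c\<close> with only the colour of the new edge
    prescribed.\<close>
  have no_add: "contains_copy (V, {e' \<in> insert e E. c' e' = Red}) C4 \<or>
      (\<exists>v. \<not> edeg {e' \<in> insert e E. c' e' = Blue} v < k)"
    if "e \<in> pairs_of V" "e \<notin> E" for e c'
  proof -
    have "\<not> critical_colouring k (add_edge G e) c'"
      using assms(5) that by (auto simp: co_critical_def complement_edges_def V_def E_def)
    moreover have sg: "simple_graph (add_edge G e)" using finV EV that
      by (auto simp: simple_graph_def add_edge_def V_def E_def verts_def edges_def)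
    ultimately have "\<not> (\<not> contains_copy (verts (add_edge G e), {e' \<in> edges (add_edge G e). c' e' = Red}) C4 \<and>
        (\<forall>v. edeg {e' \<in> edges (add_edge G e). c' e' = Blue} v < k))"
      unfolding critical_colouring_iff[OF sg k1] by simp
    moreover have "verts (add_edge G e) = V" "edges (add_edge G e) = insert e E"
      by (simp_all add: add_edge_def V_def E_def verts_def edges_def)
    ultimately show ?thesis by simp
  qed
  have pair: "{u, v} \<in> pairs_of V" if "u \<in> V" "v \<in> V" "u \<noteq> v" for u v
    using that by (auto simp: pairs_of_def)

  interpret red: sgraph V "\<lambda>u v. {u, v} \<in> Rd" using finV RdV by (rule sgraph_edges)
  interpret red: C4_saturated V "\<lambda>u v. {u, v} \<in> Rd"
  proof
    fix a b c d
    assume "{b, a} \<in> Rd" "{b, c} \<in> Rd" "{d, a} \<in> Rd" "{d, c} \<in> Rd" "a \<noteq> c"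
    then have "{a, b} \<in> Rd" "{b, c} \<in> Rd" "{c, d} \<in> Rd" "{d, a} \<in> Rd" "a \<noteq> c"
      by (simp_all add: insert_commute)
    then show "b = d" using noC4 unfolding contains_C4_iff[OF RdV] by blast
  next
    fix u v assume uv: "u \<in> V" "v \<in> V" "u \<noteq> v" "{u, v} \<notin> Rd"
    define c' where "c' = c({u, v} := Red)"
    \<comment> \<open>Recolouring a blue edge red only lowers blue degrees, so by maximality of the
      red edge set a red 4-cycle must appear. A non-edge added in red leaves the blue degrees
      unchanged.\<close>
    have "contains_copy (V, insert {u, v} Rd) C4"
    proof (cases "{u, v} \<in> E")
      case True
      have R': "cls c' Red = insert {u, v} Rd"
        using True by (auto simp: cls_def c'_def Rd_def)
      moreover have "finite Rd" using finite_edges[OF finV RdV] .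
      ultimately have "\<not> crit c'" using cmax[of c'] uv(4) by (auto simp: Rd_def)
      moreover have "cls c' Blue \<subseteq> Bl" by (auto simp: cls_def c'_def Bl_def)
      then have "edeg (cls c' Blue) v < k" for v
        using edeg_mono[OF finV _ BlV] blue le_less_trans by blast
      ultimately show ?thesis using R' crit by auto
    next
      case False
      have "{e' \<in> insert {u, v} E. c' e' = Red} = insert {u, v} Rd"
        "{e' \<in> insert {u, v} E. c' e' = Blue} = Bl"
        using False by (auto simp: c'_def Rd_def Bl_def cls_def)
      then show ?thesis using no_add[OF pair[OF uv(1-3)] False, of c'] blue by auto
    qed
    from path_of_new_C4[OF RdV pair[OF uv(1-3)] noC4 this]
    show "\<exists>p q. {u, p} \<in> Rd \<and> {p, q} \<in> Rd \<and> {q, v} \<in> Rd" .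
  qed

  define S where "S = {v \<in> V. edeg Bl v + 2 \<le> k}"
  have clique: "{u, v} \<in> E" if uv: "u \<in> S" "v \<in> S" "u \<noteq> v" for u v
  proof (rule ccontr)
    assume n: "{u, v} \<notin> E"
    define c' where "c' = c({u, v} := Blue)"
    have p: "{u, v} \<in> pairs_of V" using uv pair by (auto simp: S_def)
    have "{e' \<in> insert {u, v} E. c' e' = Red} = Rd"
      "{e' \<in> insert {u, v} E. c' e' = Blue} = insert {u, v} Bl"
      using n by (auto simp: c'_def Rd_def Bl_def cls_def)
    then obtain w where "\<not> edeg (insert {u, v} Bl) w < k"
      using no_add[OF p n, of c'] noC4 by auto
    \<comment> \<open>Blue degrees rise only at \<open>u\<close> and \<open>v\<close>, by at most
      one, from at most \<open>k - 2\<close>; no blue star can appear.\<close>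
    then show False
      using edeg_insert_le[OF finV BlV uv(3), of w] blue[of w] uv by (auto simp: S_def split: if_splits)
  qed
  define f where "f = nat \<lfloor>sqrt (real k - 2)\<rfloor>"
  have f: "int f = \<lfloor>sqrt (real k - 2)\<rfloor>" using assms(1) by (simp add: f_def)
  have "sqrt (real k - 2) < real (f + 1)" using f by linarith
  then have "real k - 2 < real (f + 1) ^ 2"
    using assms(1) by (metis real_sqrt_less_iff of_nat_0_le_iff real_sqrt_unique)
  \<comment> \<open>Between integers the strict inequality gains one:
    \<open>k - 1 \<le> (f + 1) ^ 2\<close>.\<close>
  then have "real (k - 2) < real ((f + 1) ^ 2)" using assms(1) by (simp add: of_nat_diff)
  then have kf: "k \<le> (f + 1) ^ 2 + 1" by linarith
  \<comment> \<open>The shortfall of the blue degree sum from \<open>(k - 1) * n\<close>: blue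
    degrees are at most \<open>k - 1\<close>, with equality outside \<open>S\<close>.\<close>
  define L where "L = (\<Sum>v\<in>S. k - 1 - edeg Bl v)"
  have L: "L \<le> max ((k - 1) * (k + f)) (k + f + 1)"
    unfolding L_def
  proof (rule red.sum_deficit_le[OF _ _ _ kf])
    show "S \<subseteq> V" by (auto simp: S_def)
    fix v assume v: "v \<in> S"
    then show "edeg Bl v + 2 \<le> k" by (simp add: S_def)
    have finS: "finite S" using finV by (simp add: S_def)
    \<comment> \<open>As \<open>S\<close> is a clique, each other vertex of \<open>S\<close> is a
      blue or a red neighbour of \<open>v\<close>.\<close>
    have "S - {v} \<subseteq> {w. {v, w} \<in> Bl} \<union> (red.nb v \<inter> S)"
    proof
      fix w assume "w \<in> S - {v}"
      then show "w \<in> {w. {v, w} \<in> Bl} \<union> (red.nb v \<inter> S)"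
        using clique[OF v, of w] E_eq by auto
    qed
    then have "card (S - {v}) \<le> card ({w. {v, w} \<in> Bl} \<union> (red.nb v \<inter> S))"
      by (intro card_mono) (use finite_edge_nbs[OF finV BlV] in auto)
    also have "\<dots> \<le> edeg Bl v + card (red.nb v \<inter> S)"
      unfolding edeg_def by (rule card_Un_le)
    finally show "card S \<le> edeg Bl v + card (red.nb v \<inter> S) + 1"
      using v finS by (simp add: card_Diff_singleton_if split: if_splits)
  qed
  have "(\<Sum>v\<in>V. edeg Bl v) + L = n * (k - 1)"
  proof -
    have "L = (\<Sum>v\<in>V. if edeg Bl v + 2 \<le> k then k - 1 - edeg Bl v else 0)"
      unfolding L_def S_def by (rule sum.inter_filter[OF finV])
    then have "(\<Sum>v\<in>V. edeg Bl v) + L =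
        (\<Sum>v\<in>V. edeg Bl v + (if edeg Bl v + 2 \<le> k then k - 1 - edeg Bl v else 0))"
      by (simp add: sum.distrib)
    also have "\<dots> = (\<Sum>v\<in>V. k - 1)"
    proof (rule sum.cong[OF refl])
      show "edeg Bl v + (if edeg Bl v + 2 \<le> k then k - 1 - edeg Bl v else 0) = k - 1" for v
        using blue[of v] by auto
    qed
    finally show ?thesis using cardV by simp
  qed
  then have eB: "2 * card Bl + L = n * (k - 1)" using sum_edeg[OF finV BlV] by simp
  have "(\<Sum>v\<in>V. card (red.nb v)) = 2 * card Rd"
    using sum_edeg[OF finV RdV] by (simp add: edeg_def red.nb_def)
  then have eR: "3 * n \<le> 2 * card Rd + 6" using red.sum_deg_saturated n2 cardV by simp
  have cE: "card E = card Rd + card Bl"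
    using finE disj by (simp add: E_eq card_Un_disjoint)
  have "n * k + 2 * n \<le> 2 * card E + 6 + (k - 1) * (k + f)"
  proof -
    have nk: "n * (k - 1) + n = n * k" using k1 by (cases k) auto
    show ?thesis
    proof (cases "L \<le> (k - 1) * (k + f)")
      case True
      then show ?thesis using eB eR cE nk by linarith
    next
      case False
      then have L': "L \<le> k + f + 1" using L by simp
      \<comment> \<open>For \<open>k \<ge> 3\<close>,
        \<open>(k - 1) * (k + f) \<ge> 2 * (k + f) \<ge> k + f + 1\<close>, so the second term of
        the maximum is not larger.\<close>
      have "k = 2"
      proof (rule ccontr)
        assume "k \<noteq> 2"
        then have "2 * (k + f) \<le> (k - 1) * (k + f)" using assms(1) by (intro mult_right_mono) auto
        also have "\<dots> < L" using False by simp
        finally show False using L' k1 by presburger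
      qed
      then have "f = 0" by (simp add: f_def)
      \<comment> \<open>Now \<open>L \<le> 3\<close> while the target allows a deficit of 2. Both
        \<open>2 * card E\<close> and \<open>4 * n\<close> are even, so 9 improves to 8.\<close>
      then have "2 * card E + 9 \<ge> 4 * n" using eB eR cE L' \<open>k = 2\<close> by simp
      then have "2 * card E + 8 \<ge> 4 * n" by presburger
      then show ?thesis using \<open>k = 2\<close> \<open>f = 0\<close> by simp
    qed
  qed
  then have "real (n * k + 2 * n) \<le> real (2 * card E + 6 + (k - 1) * (k + f))" by (rule of_nat_mono)
  then have "real n * real k + 2 * real n \<le> 2 * real (card E) + 6 + (real k - 1) * (real k + real f)"
    using k1 by (simp add: of_nat_diff)
  moreover have "real f = of_int \<lfloor>sqrt (real k - 2)\<rfloor>" using f by (metis of_int_of_nat_eq)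
  ultimately show ?thesis unfolding E_def[symmetric] by (simp add: field_simps)
qed

end
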